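(* Let $n>2$ be an integer, let $0<p<1$, and let $\bm{X}=\{X_i\}_{i=1}^n$ be a sequence of independent Bernoulli trials, each with probability of success $\mathbb{P}(X_i=1)=p$. Let $I_1(\bm{X})=\{i\in\{2,\dots,n\}:X_{i-1}=1\}$ be the set of trials that immediately follow a success, and let $\hat{P}_1(\bm{X}):=\sum_{i\in I_1(\bm{X})}X_i/|I_1(\bm{X})|$ (defined when $I_1(\bm{X})\neq\emptyset$). Then $$E\left[\hat{P}_1(\bm{X})\,\middle|\,I_1(\bm{X})\neq\emptyset\right]=\frac{\left[p-\frac{1-(1-p)^n}{n}\right]\frac{n}{n-1}}{1-(1-p)^{n-1}}<p.$$
   Context: Each $X_i$ takes values in $\{0,1\}$; $X_i=1$ is a "success" and $X_i=0$ a "failure". *)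

theory Defs
  imports "HOL-Probability.Probability"
begin

definition bernoulli_trials :: "'a measure \<Rightarrow> nat \<Rightarrow> real \<Rightarrow> (nat \<Rightarrow> 'a \<Rightarrow> real) \<Rightarrow> bool" where
  "bernoulli_trials M n p X \<longleftrightarrow>
     prob_space M \<and>
     prob_space.indep_vars M (\<lambda>_. borel) X {1..n} \<and>
     (\<forall>i\<in>{1..n}. \<forall>\<omega>\<in>space M. X i \<omega> \<in> {0, 1}) \<and>
     (\<forall>i\<in>{1..n}. measure M {\<omega> \<in> space M. X i \<omega> = 1} = p)"

definition I1 :: "nat \<Rightarrow> (nat \<Rightarrow> real) \<Rightarrow> nat set" where
  "I1 n x = {i \<in> {2..n}. x (i - 1) = 1}"

(* Meaningful only when I1 n x is nonempty; by the convention y / 0 = 0 it is 0 otherwise. *)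
definition P1_hat :: "nat \<Rightarrow> (nat \<Rightarrow> real) \<Rightarrow> real" where
  "P1_hat n x = (\<Sum>i\<in>I1 n x. x i) / real (card (I1 n x))"

(* Expectation of Y conditional on an event A of positive probability: uniform_measure M A
   is the conditional probability measure that sends B to P(A \<inter> B) / P(A). *)
definition expectation_given :: "'a measure \<Rightarrow> ('a \<Rightarrow> real) \<Rightarrow> 'a set \<Rightarrow> real" where
  "expectation_given M Y A = integral\<^sup>L (uniform_measure M A) Y"

end

theory Submission
  imports Defs
begin

text \<open>
  Condition on the set \<open>B\<close> of successes among the first \<open>m = n - 1\<close> trials. On \<open>B \<noteq> {}\<close> the statistic
  is the number of successes following a success divided by \<open>card B\<close>, and the weight of \<open>B\<close> depends on
  \<open>card B\<close> only. By this symmetry and double counting, the transition into trial \<open>n\<close> contributes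
  \<open>p q / m\<close>, where \<open>q = 1 - (1 - p)^m\<close>, and each of the \<open>m - 1\<close> earlier transitions contributes
  \<open>(p - q / m) / (m - 1)\<close>. Dividing the total \<open>p - q / m + p q / m\<close> by \<open>q\<close> gives the formula, and
  the inequality amounts to \<open>m (1 - p)^(m - 1) < 1 + (1 - p) + \<dots> + (1 - p)^(m - 1)\<close>.
\<close>

section \<open>Sums over intervals of sets\<close>

lemma sum_Pow_card_cong:
  fixes h :: "nat \<Rightarrow> 'c::comm_monoid_add"
  assumes "finite S" "finite T" "card S = card T"
  shows "(\<Sum>B\<in>Pow S. h (card B)) = (\<Sum>B\<in>Pow T. h (card B))"
proof -
  obtain g where g: "bij_betw g S T"
    using assms finite_same_card_bij by blast
  have "(\<Sum>B\<in>Pow S. h (card B)) = (\<Sum>B\<in>Pow S. h (card (g ` B)))"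
    using g by (intro sum.cong refl) (metis PowD bij_betw_def card_image inj_on_subset)
  also have "\<dots> = (\<Sum>B\<in>Pow T. h (card B))"
    using sum.reindex_bij_betw[OF bij_betw_Pow[OF g], of "\<lambda>B. h (card B)"] .
  finally show ?thesis .
qed

text \<open>Here \<open>{D..T}\<close> is an interval for inclusion: its members are the sets
  between \<open>D\<close> and \<open>T\<close>. Removing \<open>D\<close> turns it into a full
  power set.\<close>

lemma sum_interval_eq_sum_Pow:
  fixes f :: "'a set \<Rightarrow> 'c::comm_monoid_add"
  assumes "D \<subseteq> T"
  shows "(\<Sum>B\<in>{D..T}. f B) = (\<Sum>C\<in>Pow (T - D). f (D \<union> C))"
  using assms
  by (intro sum.reindex_bij_witness[where i="\<lambda>C. D \<union> C" and j="\<lambda>B. B - D"]) (auto simp: Un_absorb1)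

text \<open>The symmetry behind the whole computation: after removing the lower end, only the
  numbers of forced and of free elements matter.\<close>

lemma sum_interval_card_cong:
  fixes h :: "nat \<Rightarrow> 'c::comm_monoid_add"
  assumes T: "finite T" and D: "D \<subseteq> T" "D' \<subseteq> T" "card D = card D'"
  shows "(\<Sum>B\<in>{D..T}. h (card B)) = (\<Sum>B\<in>{D'..T}. h (card B))"
proof -
  have eq: "(\<Sum>B\<in>{E..T}. h (card B)) = (\<Sum>C\<in>Pow (T - E). h (card E + card C))"
    if "E \<subseteq> T" for E
    unfolding sum_interval_eq_sum_Pow[OF that]
    using T that finite_subset
    by (intro sum.cong refl arg_cong[where f=h] card_Un_disjoint) (blast intro: finite_subset)+
  have "card (T - D) = card (T - D')"
    using assms by (metis card_Diff_subset finite_subset)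
  then show ?thesis
    using T D sum_Pow_card_cong[of "T - D" "T - D'" "\<lambda>k. h (card D + k)"]
    by (simp add: eq)
qed

lemma sum_Pow_of_bool_superset:
  fixes f :: "'a set \<Rightarrow> 'c::semiring_1"
  assumes "finite T"
  shows "(\<Sum>B\<in>Pow T. of_bool (D \<subseteq> B) * f B) = (\<Sum>B\<in>{D..T}. f B)"
  using assms by (intro sum.mono_neutral_cong_right) auto

text \<open>Double counting of the pairs \<open>(j, B)\<close> with \<open>j\<close> in
  \<open>B - D\<close>. By symmetry every \<open>j\<close> in \<open>T - D\<close> contributes as
  much as \<open>i\<close>, which gives the factor on the left; counting by \<open>B\<close> first
  gives the right side.\<close>

lemma sum_interval_insert:
  fixes h :: "nat \<Rightarrow> real"
  assumes T: "finite T" and D: "D \<subseteq> T" and i: "i \<in> T - D"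
  shows "real (card (T - D)) * (\<Sum>B\<in>{insert i D..T}. h (card B))
       = (\<Sum>B\<in>{D..T}. real (card (B - D)) * h (card B))"
proof -
  have fin: "finite {D..T}"
    by (rule finite_subset[of _ "Pow T"]) (use T in auto)
  have "real (card (T - D)) * (\<Sum>B\<in>{insert i D..T}. h (card B))
      = (\<Sum>j\<in>T - D. \<Sum>B\<in>{insert i D..T}. h (card B))"
    by simp
  also have "\<dots> = (\<Sum>j\<in>T - D. \<Sum>B\<in>{insert j D..T}. h (card B))"
  proof (rule sum.cong[OF refl], rule sum_interval_card_cong)
    fix j assume "j \<in> T - D"
    then show "card (insert i D) = card (insert j D)"
      using i finite_subset[OF D T] by simp
  qed (use T D i in auto)
  also have "\<dots> = (\<Sum>j\<in>T - D. \<Sum>B\<in>{D..T}. if j \<in> B then h (card B) else 0)"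
    by (rule sum.cong[OF refl], rule sum.mono_neutral_cong_left[OF fin]) auto
  also have "\<dots> = (\<Sum>B\<in>{D..T}. \<Sum>j\<in>T - D. if j \<in> B then h (card B) else 0)"
    by (rule sum.swap)
  also have "\<dots> = (\<Sum>B\<in>{D..T}. real (card (B - D)) * h (card B))"
  proof (intro sum.cong refl)
    fix B assume "B \<in> {D..T}"
    then have "{j \<in> T - D. j \<in> B} = B - D" by auto
    then show "(\<Sum>j\<in>T - D. if j \<in> B then h (card B) else 0) = real (card (B - D)) * h (card B)"
      using T by (simp add: sum.inter_filter[symmetric])
  qed
  finally show ?thesis .
qed

text \<open>The probability that all trials in \<open>D\<close> succeed. The other trials sum out by
  expanding the product of the factors \<open>p + (1 - p) = 1\<close> over
  \<open>T - D\<close>.\<close>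

lemma sum_interval_binomial_weight:
  fixes p :: real
  assumes T: "finite T" and D: "D \<subseteq> T"
  shows "(\<Sum>B\<in>{D..T}. p ^ card B * (1 - p) ^ (card T - card B)) = p ^ card D"
proof -
  have fD: "finite D" using assms finite_subset by blast
  have "(\<Sum>B\<in>{D..T}. p ^ card B * (1 - p) ^ (card T - card B))
      = (\<Sum>C\<in>Pow (T - D). p ^ card D * ((\<Prod>x\<in>C. p) * (\<Prod>x\<in>T - D - C. 1 - p)))"
    unfolding sum_interval_eq_sum_Pow[OF D]
  proof (intro sum.cong refl)
    fix C assume C: "C \<in> Pow (T - D)"
    then have fC: "finite C" using T finite_subset by blast
    have "card (D \<union> C) = card D + card C"
      using C fD fC by (intro card_Un_disjoint) auto
    moreover have "card (T - D - C) = card T - card D - card C"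
      using C T D fD fC by (simp add: card_Diff_subset)
    ultimately show "p ^ card (D \<union> C) * (1 - p) ^ (card T - card (D \<union> C))
        = p ^ card D * ((\<Prod>x\<in>C. p) * (\<Prod>x\<in>T - D - C. 1 - p))"
      by (simp add: power_add)
  qed
  also have "\<dots> = p ^ card D * (\<Prod>x\<in>T - D. p + (1 - p))"
    using T by (subst prod_add) (auto simp: sum_distrib_left)
  finally show ?thesis by simp
qed

text \<open>Serves to split off the outcome of the last trial, with
  \<open>a = Suc m\<close>.\<close>

lemma sum_Pow_insert:
  fixes f :: "'a set \<Rightarrow> 'c::comm_monoid_add"
  assumes "finite T" "a \<notin> T"
  shows "(\<Sum>A\<in>Pow (insert a T). f A) = (\<Sum>B\<in>Pow T. f B + f (insert a B))"
proof -
  have "inj_on (insert a) (Pow T)"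
    using assms(2) by (intro inj_onI) (metis PowD insert_ident subsetD)
  moreover have "Pow T \<inter> insert a ` Pow T = {}"
    using assms(2) by auto
  ultimately show ?thesis
    using assms(1) unfolding Pow_insert
    by (subst sum.union_disjoint) (auto simp: sum.reindex sum.distrib)
qed

section \<open>The statistic as a function of the set of successes\<close>

text \<open>This and the next lemma allow a sample to be replaced by the indicator of its set of
  successes, since the two are only known to agree on \<open>{1..n}\<close>.\<close>

lemma I1_cong:
  assumes "\<And>i. i \<in> {1..n} \<Longrightarrow> x i = y i"
  shows "I1 n x = I1 n y"
proof -
  have "x (i - 1) = y (i - 1)" if "i \<in> {2..n}" for i
    using that by (intro assms) auto
  then show ?thesis by (auto simp: I1_def)
qed

lemma P1_hat_cong:
  assumes "\<And>i. i \<in> {1..n} \<Longrightarrow> x i = y i"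
  shows "P1_hat n x = P1_hat n y"
proof -
  have "(\<Sum>i\<in>I1 n y. x i) = (\<Sum>i\<in>I1 n y. y i)"
    using assms by (intro sum.cong) (auto simp: I1_def)
  then show ?thesis
    using I1_cong[OF assms] by (simp add: P1_hat_def)
qed

text \<open>Each success among the first \<open>m\<close> trials is sent to its successor. Trial
  \<open>Suc m\<close> has no successor, so its outcome does not affect the denominator of
  \<open>P1_hat\<close>.\<close>

lemma card_I1_indicator:
  "card (I1 (Suc m) (indicator A)) = card (A \<inter> {1..m})"
proof -
  have "I1 (Suc m) (indicator A) = Suc ` (A \<inter> {1..m})"
  proof (intro set_eqI)
    fix i
    show "i \<in> I1 (Suc m) (indicator A) \<longleftrightarrow> i \<in> Suc ` (A \<inter> {1..m})"
      by (cases i) (auto simp: I1_def indicator_def)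
  qed
  then show ?thesis by (simp add: card_image)
qed

lemma finite_I1: "finite (I1 n x)"
  by (simp add: I1_def)

lemma P1_hat_indicator:
  "P1_hat (Suc m) (indicator A)
     = (\<Sum>i\<in>{2..Suc m}. of_bool ({i - 1, i} \<subseteq> A)) / real (card (A \<inter> {1..m}))"
proof -
  have "(\<Sum>i\<in>I1 (Suc m) (indicator A). indicator A i)
      = (\<Sum>i\<in>{2..Suc m}. of_bool ({i - 1, i} \<subseteq> A) :: real)"
    unfolding I1_def sum.inter_filter[OF finite_atLeastAtMost]
    by (intro sum.cong refl) (auto simp: indicator_def)
  then show ?thesis
    by (simp add: P1_hat_def card_I1_indicator)
qed

section \<open>Binomial weights summed over the sets of successes\<close>

lemma sum_weight_nonempty:
  fixes p :: real
  assumes "finite T"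
  shows "(\<Sum>B\<in>Pow T. of_bool (B \<noteq> {}) * (p ^ card B * (1 - p) ^ (card T - card B)))
       = 1 - (1 - p) ^ card T"
proof -
  let ?w = "\<lambda>B. p ^ card B * (1 - p) ^ (card T - card B)"
  have "1 = (\<Sum>B\<in>Pow T. ?w B)"
    using sum_interval_binomial_weight[OF assms, of "{}" p]
    by (simp add: atLeastAtMost_def atLeast_def atMost_def Pow_def)
  also have "\<dots> = ?w {} + (\<Sum>B\<in>Pow T - {{}}. ?w B)"
    using assms sum.remove[of "Pow T" "{}" ?w] by simp
  also have "(\<Sum>B\<in>Pow T - {{}}. ?w B) = (\<Sum>B\<in>Pow T. of_bool (B \<noteq> {}) * ?w B)"
    using assms by (intro sum.mono_neutral_cong_left) auto
  finally show ?thesis by simp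
qed

text \<open>The probability of the conditioning event. It depends on the first \<open>m\<close>
  trials only, so the factors \<open>1 - p\<close> and \<open>p\<close> of the two outcomes of the
  last trial add up to 1.\<close>

lemma sum_weight_I1_nonempty:
  fixes p :: real
  shows "(\<Sum>A\<in>Pow {1..Suc m}. of_bool (I1 (Suc m) (indicator A) \<noteq> {})
            * (p ^ card A * (1 - p) ^ (Suc m - card A))) = 1 - (1 - p) ^ m"
proof -
  let ?T = "{1..m}"
  let ?f = "\<lambda>A. of_bool (I1 (Suc m) (indicator A) \<noteq> {}) * (p ^ card A * (1 - p) ^ (Suc m - card A))"
  have ne: "I1 (Suc m) (indicator A) \<noteq> {} \<longleftrightarrow> A \<inter> ?T \<noteq> {}" for A
    using card_I1_indicator[of m A] finite_I1[of "Suc m" "indicator A"]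
    by (metis card_eq_0_iff finite_Int finite_atLeastAtMost)
  have "(\<Sum>A\<in>Pow {1..Suc m}. ?f A) = (\<Sum>B\<in>Pow ?T. ?f B + ?f (insert (Suc m) B))"
    using sum_Pow_insert[of ?T "Suc m" ?f] by (simp add: atLeastAtMostSuc_conv)
  also have "\<dots> = (\<Sum>B\<in>Pow ?T. of_bool (B \<noteq> {}) * (p ^ card B * (1 - p) ^ (card ?T - card B)))"
  proof (intro sum.cong refl)
    fix B assume B: "B \<in> Pow ?T"
    then have fB: "finite B" "Suc m \<notin> B" by (auto intro: finite_subset)
    have "card B \<le> m" using B card_mono[of ?T B] by simp
    moreover have "B \<inter> ?T = B" "insert (Suc m) B \<inter> ?T = B" using B by auto
    ultimately show "?f B + ?f (insert (Suc m) B)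
        = of_bool (B \<noteq> {}) * (p ^ card B * (1 - p) ^ (card ?T - card B))"
      unfolding ne using fB by (simp add: Suc_diff_le algebra_simps)
  qed
  also have "\<dots> = 1 - (1 - p) ^ m"
    using sum_weight_nonempty[of ?T p] by simp
  finally show ?thesis .
qed

text \<open>The expectation before normalisation. Samples without a success among the first
  \<open>m\<close> trials contribute 0, because \<open>P1_hat\<close> is 0 there by the convention
  for division by zero.\<close>

lemma sum_weight_P1_hat:
  fixes p :: real
  assumes m: "m \<ge> 2"
  shows "(\<Sum>A\<in>Pow {1..Suc m}. P1_hat (Suc m) (indicator A) * (p ^ card A * (1 - p) ^ (Suc m - card A)))
       = p - (1 - (1 - p) ^ m) / m + p * (1 - (1 - p) ^ m) / m"
proof -
  let ?T = "{1..m}"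
  let ?q = "1 - (1 - p) ^ m"
  define w where "w k = p ^ k * (1 - p) ^ (m - k)" for k
  \<comment> \<open>The weight for the first \<open>m\<close> trials over the denominator of
    \<open>P1_hat\<close>. Since \<open>h 0 = 0\<close>, cancelling \<open>k\<close> recovers
    \<open>w k\<close> only for nonzero \<open>k\<close>.\<close>
  define h where "h k = w k / real k" for k
  define f where "f A = P1_hat (Suc m) (indicator A) * (p ^ card A * (1 - p) ^ (Suc m - card A))" for A
  have int_Pow: "{{}..?T} = Pow ?T" by (simp only: atLeastAtMost_def atLeast_def atMost_def Pow_def) simp
  have h_cancel: "real k * h k = of_bool (k \<noteq> 0) * w k" for k
    by (simp add: h_def)

  \<comment> \<open>Double counting from \<open>{}\<close>: multiplying by \<open>m\<close> cancels
    the denominators and leaves the total weight of the nonempty sets.\<close>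
  have one: "(\<Sum>B\<in>{{i}..?T}. h (card B)) = ?q / m" if "i \<in> ?T" for i
  proof -
    have "real m * (\<Sum>B\<in>{{i}..?T}. h (card B)) = (\<Sum>B\<in>Pow ?T. real (card B) * h (card B))"
      using sum_interval_insert[of ?T "{}" i h] that unfolding int_Pow by simp
    also have "\<dots> = (\<Sum>B\<in>Pow ?T. of_bool (B \<noteq> {}) * (p ^ card B * (1 - p) ^ (card ?T - card B)))"
      unfolding h_cancel w_def
      by (intro sum.cong refl) (auto simp: card_eq_0_iff dest: finite_subset)
    also have "\<dots> = ?q"
      using sum_weight_nonempty[of ?T p] by simp
    finally show ?thesis using m by (simp add: field_simps)
  qed

  \<comment> \<open>Double counting from \<open>{i - 1}\<close>: each \<open>B\<close> now counts
    \<open>card B - 1\<close> times, which turns \<open>h\<close> into \<open>w - h\<close>. The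
    \<open>w\<close> part sums to the probability \<open>p\<close> of success in trial
    \<open>i - 1\<close>, and the \<open>h\<close> part is \<open>one\<close>.\<close>
  have two: "(\<Sum>B\<in>{{i - 1, i}..?T}. h (card B)) = (p - ?q / m) / (m - 1)" if "i \<in> {2..m}" for i
  proof -
    have i: "i - 1 \<in> ?T" "i \<in> ?T - {i - 1}" using that by auto
    have cT: "card (?T - {i - 1}) = m - 1" using i by simp
    have "(m - 1) * (\<Sum>B\<in>{{i - 1, i}..?T}. h (card B))
        = (\<Sum>B\<in>{{i - 1}..?T}. real (card (B - {i - 1})) * h (card B))"
      using sum_interval_insert[of ?T "{i - 1}" i h] i unfolding cT
      by (simp add: insert_commute)
    also have "\<dots> = (\<Sum>B\<in>{{i - 1}..?T}. w (card B) - h (card B))"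
    proof (intro sum.cong refl)
      fix B assume B: "B \<in> {{i - 1}..?T}"
      then have fB: "finite B" "i - 1 \<in> B" by (auto intro: finite_subset)
      then have "card B > 0" by (auto simp: card_gt_0_iff)
      then have "real (card (B - {i - 1})) = real (card B) - 1"
        using fB by (simp add: of_nat_diff)
      then show "real (card (B - {i - 1})) * h (card B) = w (card B) - h (card B)"
        using h_cancel[of "card B"] \<open>card B > 0\<close> by (simp only: left_diff_distrib) simp
    qed
    also have "\<dots> = p - ?q / m"
      using sum_interval_binomial_weight[of ?T "{i - 1}" p] one[OF i(1)] i
      by (simp add: sum_subtractf w_def)
    finally show ?thesis using m by (simp add: field_simps)
  qed

  have interval: "(\<Sum>B\<in>Pow ?T. of_bool (D \<subseteq> B) * h (card B)) = (\<Sum>B\<in>{D..?T}. h (card B))" for D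
    by (simp only: sum_Pow_of_bool_superset finite_atLeastAtMost)

  have "(\<Sum>A\<in>Pow {1..Suc m}. f A) = (\<Sum>B\<in>Pow ?T. f B + f (insert (Suc m) B))"
    using sum_Pow_insert[of ?T "Suc m" f] by (simp add: atLeastAtMostSuc_conv)
  \<comment> \<open>Transitions inside the first \<open>m\<close> trials ignore the last outcome, so
    its two factors add up to 1. The transition from \<open>m\<close> to \<open>Suc m\<close> counts
    only when the last trial succeeds, hence the factor \<open>p\<close>.\<close>
  also have "\<dots> = (\<Sum>B\<in>Pow ?T. (\<Sum>i\<in>{2..m}. of_bool ({i - 1, i} \<subseteq> B) * h (card B))
                                 + p * (of_bool ({m} \<subseteq> B) * h (card B)))"
  proof (intro sum.cong refl)
    fix B assume B: "B \<in> Pow ?T"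
    then have fB: "finite B" "Suc m \<notin> B" by (auto intro: finite_subset)
    have cB: "card B \<le> m" using B card_mono[of ?T B] by simp
    have int: "B \<inter> ?T = B" "insert (Suc m) B \<inter> ?T = B" using B by auto
    define c :: real where "c = (\<Sum>i\<in>{2..m}. of_bool ({i - 1, i} \<subseteq> B))"
    have split: "{2..Suc m} = insert (Suc m) {2..m}" using m by auto
    have "(\<Sum>i\<in>{2..Suc m}. of_bool ({i - 1, i} \<subseteq> B)) = c"
      unfolding split c_def using fB by simp
    then have P: "P1_hat (Suc m) (indicator B) = c / card B"
      by (simp only: P1_hat_indicator int)
    have "(\<Sum>i\<in>{2..m}. of_bool ({i - 1, i} \<subseteq> insert (Suc m) B)) = c"
      unfolding c_def by (intro sum.cong refl) auto
    then have "(\<Sum>i\<in>{2..Suc m}. of_bool ({i - 1, i} \<subseteq> insert (Suc m) B)) = c + of_bool ({m} \<subseteq> B)"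
      unfolding split by (subst sum.insert) (simp_all only: finite_atLeastAtMost, simp_all)
    then have P': "P1_hat (Suc m) (indicator (insert (Suc m) B)) = (c + of_bool ({m} \<subseteq> B)) / card B"
      by (simp only: P1_hat_indicator int)
    have "f B + f (insert (Suc m) B) = c * h (card B) + p * (of_bool ({m} \<subseteq> B) * h (card B))"
      unfolding f_def P P' h_def w_def using fB cB
      by (simp add: Suc_diff_le add_divide_distrib algebra_simps)
    then show "f B + f (insert (Suc m) B) = (\<Sum>i\<in>{2..m}. of_bool ({i - 1, i} \<subseteq> B) * h (card B))
                                 + p * (of_bool ({m} \<subseteq> B) * h (card B))"
      by (simp add: c_def sum_distrib_right)
  qed
  also have "\<dots> = (\<Sum>i\<in>{2..m}. \<Sum>B\<in>Pow ?T. of_bool ({i - 1, i} \<subseteq> B) * h (card B))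
                 + p * (\<Sum>B\<in>Pow ?T. of_bool ({m} \<subseteq> B) * h (card B))"
    unfolding sum.distrib sum_distrib_left
    by (subst sum.swap) (rule refl)
  \<comment> \<open>The \<open>m - 1\<close> earlier transitions have equal values, so their number
    cancels the denominator; the last one is \<open>one\<close> at \<open>m\<close>.\<close>
  also have "\<dots> = (\<Sum>i\<in>{2..m}. (p - ?q / m) / (m - 1)) + p * (?q / m)"
    unfolding interval using m
    by (intro arg_cong2[where f="(+)"] arg_cong2[where f="(*)"] sum.cong refl one two) simp_all
  also have "\<dots> = p - ?q / m + p * ?q / m"
    using m by simp
  finally show ?thesis unfolding f_def .
qed

section \<open>Bernoulli trials\<close>

lemma borel_measurable_bernoulli_trials:
  assumes "bernoulli_trials M n p X" "i \<in> {1..n}"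
  shows "X i \<in> borel_measurable M"
  using assms unfolding bernoulli_trials_def
  by (metis prob_space.indep_vars_def)

lemma prob_bernoulli_success_set:
  assumes trials: "bernoulli_trials M n p X" and n: "n \<ge> 1" and A: "A \<subseteq> {1..n}"
  shows "{\<omega> \<in> space M. {i \<in> {1..n}. X i \<omega> = 1} = A} \<in> sets M"
    and "measure M {\<omega> \<in> space M. {i \<in> {1..n}. X i \<omega> = 1} = A} = p ^ card A * (1 - p) ^ (n - card A)"
proof -
  interpret prob_space M using trials by (simp add: bernoulli_trials_def)
  note [measurable] = borel_measurable_bernoulli_trials[OF trials]
  have range: "X i \<omega> = 0 \<or> X i \<omega> = 1" if "i \<in> {1..n}" "\<omega> \<in> space M" for i \<omega>
    using trials that by (auto simp: bernoulli_trials_def)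
  let ?V = "\<lambda>i. {indicator A i :: real}"
  \<comment> \<open>Fixing the set of successes prescribes every trial, as a value other than 1 must
    be 0. With \<open>n \<ge> 1\<close> the intersection is over a nonempty index set and so stays
    inside \<open>space M\<close>.\<close>
  have ev: "{\<omega> \<in> space M. {i \<in> {1..n}. X i \<omega> = 1} = A} = (\<Inter>i\<in>{1..n}. X i -` ?V i \<inter> space M)"
  proof (intro set_eqI)
    fix \<omega>
    have "{i \<in> {1..n}. X i \<omega> = 1} = A \<longleftrightarrow> (\<forall>i\<in>{1..n}. X i \<omega> = indicator A i)" if "\<omega> \<in> space M"
      using A range[OF _ that] by (fastforce simp: indicator_def)
    then show "\<omega> \<in> {\<omega> \<in> space M. {i \<in> {1..n}. X i \<omega> = 1} = A}
        \<longleftrightarrow> \<omega> \<in> (\<Inter>i\<in>{1..n}. X i -` ?V i \<inter> space M)"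
      using n by auto
  qed
  have meas: "X i -` ?V i \<inter> space M \<in> sets M" if "i \<in> {1..n}" for i
    using that by measurable
  then show "{\<omega> \<in> space M. {i \<in> {1..n}. X i \<omega> = 1} = A} \<in> sets M"
    unfolding ev using n by (intro sets.finite_INT) auto
  have success: "prob {\<omega> \<in> space M. X i \<omega> = 1} = p" if "i \<in> {1..n}" for i
    using trials that by (simp add: bernoulli_trials_def)
  have failure: "prob {\<omega> \<in> space M. X i \<omega> = 0} = 1 - p" if i: "i \<in> {1..n}" for i
  proof -
    have "{\<omega> \<in> space M. X i \<omega> = 0} = space M - {\<omega> \<in> space M. X i \<omega> = 1}"
      using range[OF i] by auto
    moreover have "{\<omega> \<in> space M. X i \<omega> = 1} \<in> sets M"
      using i by measurable
    ultimately show ?thesis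
      using prob_compl[of "{\<omega> \<in> space M. X i \<omega> = 1}"] success[OF i] by simp
  qed
  have single: "prob (X i -` ?V i \<inter> space M) = (if i \<in> A then p else 1 - p)" if "i \<in> {1..n}" for i
    using success[OF that] failure[OF that]
    by (auto simp: vimage_def Int_def conj_commute)
  have "prob (\<Inter>i\<in>{1..n}. X i -` ?V i \<inter> space M) = (\<Prod>i\<in>{1..n}. prob (X i -` ?V i \<inter> space M))"
    using trials n unfolding bernoulli_trials_def
    by (intro indep_varsD_finite) auto
  also have "\<dots> = (\<Prod>i\<in>{1..n}. if i \<in> A then p else 1 - p)"
    by (intro prod.cong refl single)
  also have "\<dots> = (\<Prod>i\<in>A. p) * (\<Prod>i\<in>{1..n} - A. 1 - p)"
    using A by (subst prod.If_cases) (auto simp: Int_absorb1 Diff_eq)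
  also have "\<dots> = p ^ card A * (1 - p) ^ (n - card A)"
    using A by (simp add: card_Diff_subset finite_subset)
  finally show "prob {\<omega> \<in> space M. {i \<in> {1..n}. X i \<omega> = 1} = A} = p ^ card A * (1 - p) ^ (n - card A)"
    unfolding ev .
qed

text \<open>Reduces expectations to finite sums: the events of having a given set of successes
  partition the space, so a function of that set is a finite combination of their
  indicators.\<close>

lemma has_bochner_integral_bernoulli_success_set:
  fixes F :: "nat set \<Rightarrow> real"
  assumes trials: "bernoulli_trials M n p X" and n: "n \<ge> 1"
  shows "has_bochner_integral M (\<lambda>\<omega>. F {i \<in> {1..n}. X i \<omega> = 1})
           (\<Sum>A\<in>Pow {1..n}. F A * (p ^ card A * (1 - p) ^ (n - card A)))"
proof -
  interpret prob_space M using trials by (simp add: bernoulli_trials_def)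
  let ?S = "\<lambda>\<omega>. {i \<in> {1..n}. X i \<omega> = 1}"
  let ?E = "\<lambda>A. {\<omega> \<in> space M. ?S \<omega> = A}"
  note E = prob_bernoulli_success_set[OF trials n]
  have "has_bochner_integral M (\<lambda>\<omega>. \<Sum>A\<in>Pow {1..n}. F A * indicator (?E A) \<omega>)
          (\<Sum>A\<in>Pow {1..n}. F A * measure M (?E A))"
    using E(1) by (intro has_bochner_integral_sum has_bochner_integral_mult_right
        has_bochner_integral_real_indicator) (auto simp: less_top[symmetric])
  also have "(\<Sum>A\<in>Pow {1..n}. F A * measure M (?E A))
      = (\<Sum>A\<in>Pow {1..n}. F A * (p ^ card A * (1 - p) ^ (n - card A)))"
    using E(2) by (intro sum.cong refl) simp
  finally have "has_bochner_integral M (\<lambda>\<omega>. \<Sum>A\<in>Pow {1..n}. F A * indicator (?E A) \<omega>)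
      (\<Sum>A\<in>Pow {1..n}. F A * (p ^ card A * (1 - p) ^ (n - card A)))" .
  moreover have "(\<Sum>A\<in>Pow {1..n}. F A * indicator (?E A) \<omega>) = F (?S \<omega>)" if "\<omega> \<in> space M" for \<omega>
  proof -
    have "(\<Sum>A\<in>Pow {1..n}. F A * indicator (?E A) \<omega>) = (\<Sum>A\<in>Pow {1..n}. if A = ?S \<omega> then F A else 0)"
      using that by (intro sum.cong refl) (auto simp: indicator_def)
    also have "\<dots> = F (?S \<omega>)"
      by (subst sum.delta) auto
    finally show ?thesis .
  qed
  ultimately show ?thesis
    by (subst has_bochner_integral_cong[where g="\<lambda>\<omega>. \<Sum>A\<in>Pow {1..n}. F A * indicator (?E A) \<omega>"]) auto
qed

section \<open>Conditional expectation as a quotient, and the strict inequality\<close>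

lemma (in prob_space) integral_uniform_measure:
  fixes f :: "'a \<Rightarrow> real"
  assumes f [measurable]: "f \<in> borel_measurable M" and A [measurable]: "A \<in> sets M"
    and pos: "prob A > 0"
  shows "integral\<^sup>L (uniform_measure M A) f = (LINT x|M. indicator A x * f x) / prob A"
proof -
  \<comment> \<open>Writing the \<open>ennreal\<close> density as the image of a nonnegative real
    function makes \<open>integral_density\<close> applicable.\<close>
  have "uniform_measure M A = density M (\<lambda>x. ennreal (indicator A x / prob A))"
    unfolding uniform_measure_def emeasure_eq_measure
    using pos by (intro density_cong) (auto split: split_indicator simp: divide_ennreal[symmetric])
  then have "integral\<^sup>L (uniform_measure M A) f = (LINT x|M. (indicator A x / prob A) *\<^sub>R f x)"
    by (simp add: integral_density)
  also have "\<dots> = (LINT x|M. indicator A x * f x / prob A)"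
    by (intro Bochner_Integration.integral_cong) auto
  finally show ?thesis by simp
qed

text \<open>Every term of the geometric sum is at least \<open>r ^ (m - 1)\<close>, and the term for
  exponent 0 is strictly larger because \<open>m \<ge> 2\<close>. Multiplication by
  \<open>1 - r\<close> then telescopes the sum.\<close>

lemma mult_power_less_one_minus_power:
  fixes r :: real
  assumes r: "0 < r" "r < 1" and m: "m \<ge> 2"
  shows "real m * (1 - r) * r ^ (m - 1) < 1 - r ^ m"
proof -
  have "(\<Sum>i<m. r ^ (m - 1)) < (\<Sum>i<m. r ^ i)"
  proof (rule sum_strict_mono_ex1)
    have "r ^ (m - 1) < r ^ 0"
      using r m power_strict_decreasing[of 0 "m - 1" r] by simp
    then show "\<exists>i\<in>{..<m}. r ^ (m - 1) < r ^ i"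
      using m by (intro bexI[of _ 0]) auto
    show "\<forall>i\<in>{..<m}. r ^ (m - 1) \<le> r ^ i"
      using r by (auto intro!: power_decreasing)
  qed simp
  then have "(1 - r) * (real m * r ^ (m - 1)) < (1 - r) * (\<Sum>i<m. r ^ i)"
    using r by simp
  then show ?thesis
    by (simp add: one_diff_power_eq mult_ac)
qed

theorem theorem2:
  fixes M :: "'a measure" and X :: "nat \<Rightarrow> 'a \<Rightarrow> real" and n :: nat and p :: real
  assumes "n > 2"
    and "0 < p" and "p < 1"
    and "bernoulli_trials M n p X"
  shows "expectation_given M (\<lambda>\<omega>. P1_hat n (\<lambda>i. X i \<omega>))
             {\<omega> \<in> space M. I1 n (\<lambda>i. X i \<omega>) \<noteq> {}}
           = (p - (1 - (1 - p) ^ n) / real n) * (real n / (real n - 1)) / (1 - (1 - p) ^ (n - 1))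
       \<and> (p - (1 - (1 - p) ^ n) / real n) * (real n / (real n - 1)) / (1 - (1 - p) ^ (n - 1)) < p"
proof -
  interpret prob_space M using assms(4) by (simp add: bernoulli_trials_def)
  obtain m where n: "n = Suc m" and m: "m \<ge> 2"
    using assms(1) by (cases n) auto
  define r where "r = 1 - p"
  define q where "q = 1 - r ^ m"
  have r: "0 < r" "r < 1" and p: "p = 1 - r" using assms by (auto simp: r_def)
  have q: "q > 0"
    using r m power_less_one_iff[of r m] by (simp add: q_def)
  define S where "S \<omega> = {i \<in> {1..n}. X i \<omega> = 1}" for \<omega>
  define E where "E = {\<omega> \<in> space M. I1 n (\<lambda>i. X i \<omega>) \<noteq> {}}"
  define Y where "Y \<omega> = P1_hat n (\<lambda>i. X i \<omega>)" for \<omega>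
  have X: "X i \<omega> = indicator (S \<omega>) i" if "\<omega> \<in> space M" "i \<in> {1..n}" for i \<omega>
    using assms(4) that by (fastforce simp: bernoulli_trials_def S_def indicator_def)
  have I1_S: "I1 n (\<lambda>i. X i \<omega>) = I1 n (indicator (S \<omega>))"
    and Y_S: "Y \<omega> = P1_hat n (indicator (S \<omega>))" if "\<omega> \<in> space M" for \<omega>
    unfolding Y_def using X[OF that] by (intro I1_cong P1_hat_cong; simp)+

  have "has_bochner_integral M (\<lambda>\<omega>. of_bool (I1 n (indicator (S \<omega>)) \<noteq> {})) q"
    using has_bochner_integral_bernoulli_success_set[OF assms(4), of "\<lambda>A. of_bool (I1 n (indicator A) \<noteq> {})"]
      sum_weight_I1_nonempty[of m p]
    by (simp add: n S_def q_def r_def)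
  then have E_int: "has_bochner_integral M (indicator E) q"
    by (rule has_bochner_integral_cong[THEN iffD1, rotated -1]) (auto simp: E_def I1_S indicator_def)
  \<comment> \<open>Measurability of \<open>E\<close> is recovered from that of its indicator, which
    comes with \<open>E_int\<close>.\<close>
  have "E = indicator E -` {1::real} \<inter> space M"
    by (auto simp: E_def indicator_def)
  then have E: "E \<in> sets M"
    using measurable_sets[OF borel_measurable_has_bochner_integral[OF E_int], of "{1}"] by simp
  have probE: "prob E = q"
    using has_bochner_integral_integral_eq[OF E_int] E by simp

  have "has_bochner_integral M (\<lambda>\<omega>. P1_hat n (indicator (S \<omega>))) (p - q / m + p * q / m)"
    using has_bochner_integral_bernoulli_success_set[OF assms(4), of "\<lambda>A. P1_hat n (indicator A)"]
      sum_weight_P1_hat[OF m, of p]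
    by (simp add: n S_def q_def r_def)
  then have Y_int: "has_bochner_integral M Y (p - q / m + p * q / m)"
    by (rule has_bochner_integral_cong[THEN iffD1, rotated -1]) (auto simp: Y_S)
  \<comment> \<open>Outside \<open>E\<close> the set \<open>I1\<close> is empty and \<open>Y\<close>
    is 0 by convention, so restricting to \<open>E\<close> changes nothing.\<close>
  have "(LINT \<omega>|M. indicator E \<omega> * Y \<omega>) = (LINT \<omega>|M. Y \<omega>)"
    by (intro Bochner_Integration.integral_cong) (auto simp: E_def Y_def P1_hat_def indicator_def)
  then have "integral\<^sup>L (uniform_measure M E) Y = (p - q / m + p * q / m) / q"
    using integral_uniform_measure[OF borel_measurable_has_bochner_integral[OF Y_int] E]
      has_bochner_integral_integral_eq[OF Y_int] q by (simp add: probE)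
  moreover have rhs: "(p - (1 - (1 - p) ^ n) / real n) * (real n / (real n - 1)) / (1 - (1 - p) ^ (n - 1))
      = (p - q / m + p * q / m) / q"
  proof -
    have "(p - a / real n) * (real n / (real n - 1)) = (real n * p - a) / m" for a
    proof -
      have "(p - a / real n) * real n = real n * p - a"
        by (simp add: left_diff_distrib n)
      then show ?thesis by (simp add: n)
    qed
    then have "(p - (1 - (1 - p) ^ n) / real n) * (real n / (real n - 1))
        = (real n * p - (1 - (1 - p) ^ n)) / m" .
    \<comment> \<open>Uses \<open>n = m + 1\<close> and
      \<open>(1 - p) ^ n = (1 - p) * (1 - q)\<close>.\<close>
    also have "real n * p - (1 - (1 - p) ^ n) = m * p - q + p * q"
      by (simp add: n q_def p algebra_simps)
    also have "\<dots> / m = p - q / m + p * q / m"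
      using m by (simp add: field_simps)
    finally show ?thesis by (simp add: n q_def p)
  qed
  moreover have "(p - q / m + p * q / m) / q < p"
  proof -
    \<comment> \<open>The extra factor \<open>r\<close> raises the power to
      \<open>r ^ m = 1 - q\<close>. The inequality becomes
      \<open>m * p * (1 - q) < (1 - p) * q\<close>, a rearrangement of the claim multiplied by
      \<open>m * q\<close>.\<close>
    have "r * (m * p * r ^ (m - 1)) < r * q"
      using mult_power_less_one_minus_power[OF r m] r by (simp add: p q_def)
    moreover have "r * r ^ (m - 1) = 1 - q"
      using m by (simp add: q_def power_eq_if)
    then have "r * (m * p * r ^ (m - 1)) = m * p * (1 - q)"
      by (simp only: mult.left_commute[of r])
    ultimately have "m * p - q + p * q < p * q * m"
      by (simp add: p algebra_simps)
    then have "(m * p - q + p * q) / m < p * q"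
      using m by (simp add: divide_less_eq)
    moreover have "(m * p - q + p * q) / m = p - q / m + p * q / m"
      using m by (simp add: field_simps)
    ultimately show ?thesis
      using q by (simp add: divide_less_eq)
  qed
  ultimately show ?thesis
    by (simp add: expectation_given_def E_def Y_def[abs_def])
qed

end
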